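(* For every fixed integer $k\geq 1$ and every fixed real $\varepsilon>0$, as $n\to\infty$, \[ f_k(n)=\frac{1}{2k}n^2+O(h_\varepsilon(n)), \] where $h_\varepsilon(x)=x^{1+\frac{\ln 2+\varepsilon}{\ln\ln x}}$; in particular $f_k(n)=\frac{1}{2k}n^2+O(n^{1+\varepsilon})$.
   Context: Let $k$ be a positive integer and $A$ a finite set (alphabet). A sequence $x_1,\ldots,x_m$ of elements of $A$ is a $k$-radius sequence over $A$ if for every $a,b\in A$ there are indices $i,j\in\{1,\ldots,m\}$ with $x_i=a$, $x_j=b$ and $|i-j|\leq k$. $f_k(n)$ denotes the length of a shortest $k$-radius sequence over an $n$-element alphabet. *)

theory Defs
  imports Complex_Main "HOL-Library.Landau_Symbols"
begin

definition radius_sequence :: "nat \<Rightarrow> 'a set \<Rightarrow> 'a list \<Rightarrow> bool" where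
  "radius_sequence k A xs \<longleftrightarrow> set xs \<subseteq> A \<and>
     (\<forall>a\<in>A. \<forall>b\<in>A. \<exists>i<length xs. \<exists>j<length xs.
        xs ! i = a \<and> xs ! j = b \<and> \<bar>int i - int j\<bar> \<le> int k)"

(* The alphabet is taken to be {..<n}; see min_radius_length_alphabet for an arbitrary one. *)
definition min_radius_length :: "nat \<Rightarrow> nat \<Rightarrow> nat" where
  "min_radius_length k n = (LEAST m. \<exists>xs. length xs = m \<and> radius_sequence k {..<n} xs)"

definition h :: "real \<Rightarrow> real \<Rightarrow> real" where
  "h \<epsilon> x = x powr (1 + (ln 2 + \<epsilon>) / ln (ln x))"

lemma radius_sequence_map:
  assumes "bij_betw g A B" "radius_sequence k A xs"
  shows "radius_sequence k B (map g xs)"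
  unfolding radius_sequence_def
proof (intro conjI ballI)
  show "set (map g xs) \<subseteq> B"
    using assms by (auto simp: radius_sequence_def bij_betw_def)
next
  fix a b assume "a \<in> B" "b \<in> B"
  then obtain a' b' where *: "a' \<in> A" "b' \<in> A" "a = g a'" "b = g b'"
    using assms(1) by (auto simp: bij_betw_def)
  then obtain i j where "i < length xs" "j < length xs" "xs ! i = a'" "xs ! j = b'"
      "\<bar>int i - int j\<bar> \<le> int k"
    using assms(2) unfolding radius_sequence_def by blast
  with * show "\<exists>i<length (map g xs). \<exists>j<length (map g xs).
      map g xs ! i = a \<and> map g xs ! j = b \<and> \<bar>int i - int j\<bar> \<le> int k"
    by (intro exI[of _ i] exI[of _ j] conjI) auto
qed

lemma min_radius_length_alphabet:
  assumes "finite A" "card A = n"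
  shows "min_radius_length k n = (LEAST m. \<exists>xs. length xs = m \<and> radius_sequence k A xs)"
proof -
  obtain g where g: "bij_betw g {..<n} A"
    using assms ex_bij_betw_nat_finite[of A] by (auto simp: atLeast0LessThan)
  have "(\<exists>xs. length xs = m \<and> radius_sequence k {..<n} xs) \<longleftrightarrow>
        (\<exists>xs. length xs = m \<and> radius_sequence k A xs)" for m
    using radius_sequence_map[OF g] radius_sequence_map[OF bij_betw_inv_into[OF g]]
    by (metis length_map)
  then show ?thesis
    by (simp add: min_radius_length_def)
qed

lemma radius_sequence_exists:
  assumes "finite A" "k \<ge> 1"
  shows "\<exists>xs. radius_sequence k A xs"
proof -
  obtain ps where ps: "set ps = A \<times> A"
    using finite_list[of "A \<times> A"] assms(1) by auto
  define xs where "xs = concat (map (\<lambda>(a, b). [a, b]) ps)"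
  have "set xs \<subseteq> A"
    using ps by (auto simp: xs_def)
  moreover have "\<exists>i<length xs. \<exists>j<length xs. xs ! i = a \<and> xs ! j = b \<and> \<bar>int i - int j\<bar> \<le> int k"
    if ab: "a \<in> A" "b \<in> A" for a b
  proof -
    obtain us vs where "ps = us @ (a, b) # vs"
      using ab ps split_list[of "(a, b)" ps] by auto
    then obtain us' vs' where xs: "xs = us' @ a # b # vs'"
      by (auto simp: xs_def)
    show ?thesis
      by (rule exI[of _ "length us'"], simp add: xs, rule exI[of _ "Suc (length us')"])
         (use assms(2) in \<open>simp add: nth_append\<close>)
  qed
  ultimately show ?thesis
    unfolding radius_sequence_def by blast
qed

(* For k = 0 and n > 1 there is no such sequence and the value is unspecified. *)
lemma min_radius_length_attained:
  assumes "k \<ge> 1"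
  shows "\<exists>xs. length xs = min_radius_length k n \<and> radius_sequence k {..<n} xs"
proof -
  obtain ys where "radius_sequence k {..<n} ys"
    using radius_sequence_exists[OF finite_lessThan assms] by blast
  then have "\<exists>xs. length xs = length ys \<and> radius_sequence k {..<n} xs"
    by blast
  then show ?thesis
    unfolding min_radius_length_def by (rule LeastI)
qed

end

theory Submission
  imports Defs "HOL-Number_Theory.Cong" "HOL-Real_Asymp.Real_Asymp"
begin

text \<open>
  The upper bound comes from a recursion. Arrange the alphabet in $q = 2k + 1$ groups of size $m$,
  where $m$ is coprime to $k!$, and read lines $(i, s i + b)$ over the integers mod $m$ cyclically
  through the groups. In the cyclic word $0, 1, \ldots, 2k$ any two distinct letters occur exactly
  once at distance at most $k$, so each pair of letters from different groups is met exactly once,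
  up to a waste of $qm$ letters, and the pairs inside the groups are left to a shorter alphabet:
  $f_k(qm) \le q m (m + 1) + q f_k(m)$. Since $m$ is only constrained modulo $k!$, every $n$ is
  within $O(1)$ of some $qm$, and the recursion gives $f_k(n) \le n^2 / (2k) + O(n \ln n)$, which is
  sharper than both claimed error terms. The lower bound counts pairs of positions.
\<close>

section \<open>Words in which two symbols occur close together\<close>

definition close_in :: "nat \<Rightarrow> 'a list \<Rightarrow> 'a \<Rightarrow> 'a \<Rightarrow> bool" where
  "close_in k xs a b \<longleftrightarrow>
     (\<exists>i<length xs. \<exists>j<length xs. xs ! i = a \<and> xs ! j = b \<and> \<bar>int i - int j\<bar> \<le> int k)"

lemma radius_sequence_iff:
  "radius_sequence k A xs \<longleftrightarrow> set xs \<subseteq> A \<and> (\<forall>a\<in>A. \<forall>b\<in>A. close_in k xs a b)"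
  unfolding radius_sequence_def close_in_def ..

lemma close_in_sym: "close_in k xs a b \<longleftrightarrow> close_in k xs b a"
  unfolding close_in_def by (metis abs_minus_commute)

lemma close_in_append:
  assumes "close_in k xs a b"
  shows "close_in k (us @ xs @ vs) a b"
proof -
  obtain i j where "i < length xs" "j < length xs" "xs ! i = a" "xs ! j = b"
      "\<bar>int i - int j\<bar> \<le> int k"
    using assms unfolding close_in_def by blast
  then show ?thesis
    unfolding close_in_def
    by (intro exI[of _ "length us + i"] exI[of _ "length us + j"] conjI) (auto simp: nth_append)
qed

lemma close_in_concat:
  assumes "xs \<in> set xss" "close_in k xs a b"
  shows "close_in k (concat xss) a b"
proof -
  obtain uss vss where "xss = uss @ xs # vss"
    using assms(1) split_list by fast
  then show ?thesis
    using close_in_append[OF assms(2), of "concat uss" "concat vss"] by simp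
qed

lemma close_in_map:
  assumes "close_in k xs a b"
  shows "close_in k (map g xs) (g a) (g b)"
  using assms unfolding close_in_def by (metis length_map nth_map)

lemma close_in_map_upt:
  assumes "t + d < n" "d \<le> k"
  shows "close_in k (map g [0..<n]) (g t) (g (t + d))"
  unfolding close_in_def
  by (intro exI[of _ t] exI[of _ "t + d"] conjI) (use assms in auto)

lemma min_radius_length_le:
  assumes "finite A" "radius_sequence k A xs"
  shows "min_radius_length k (card A) \<le> length xs"
  unfolding min_radius_length_alphabet[OF assms(1) refl]
  using assms(2) by (intro Least_le) blast

text \<open>Sending the surplus letters to \<open>0\<close> keeps the length and every closeness
  between the remaining letters. This needs a letter \<open>0\<close>, so the empty alphabet is
  split off.\<close>

lemma min_radius_length_mono:
  assumes "k \<ge> 1" "n \<le> n'"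
  shows "min_radius_length k n \<le> min_radius_length k n'"
proof (cases "n = 0")
  case True
  have "radius_sequence k {..<0::nat} []"
    by (simp add: radius_sequence_def)
  from min_radius_length_le[OF _ this] show ?thesis
    using True by simp
next
  case False
  obtain xs where xs: "length xs = min_radius_length k n'" "radius_sequence k {..<n'} xs"
    using min_radius_length_attained[OF assms(1)] by blast
  define g where "g x = (if x < n then x else 0)" for x
  have "close_in k (map g xs) a b" if "a < n" "b < n" for a b
    using close_in_map[of k xs a b g] xs(2) that assms(2)
    by (simp add: radius_sequence_iff g_def)
  then have "radius_sequence k {..<n} (map g xs)"
    using False by (auto simp: radius_sequence_iff g_def)
  from min_radius_length_le[OF _ this] show ?thesis
    using xs(1) by simp
qed

section \<open>The lower bound\<close>

text \<open>A pair is determined by \<open>i\<close> and the nonzero difference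
  \<open>j - i\<close>, which has at most \<open>2 * k\<close> possible values.\<close>

lemma card_close_index_pairs:
  "card {(i, j). i < n \<and> j < n \<and> i \<noteq> j \<and> \<bar>int i - int j\<bar> \<le> int k} \<le> 2 * k * n"
proof -
  let ?S = "{(i, j). i < n \<and> j < n \<and> i \<noteq> j \<and> \<bar>int i - int j\<bar> \<le> int k}"
  let ?D = "{- int k..int k} - {0}"
  have "card ?S \<le> card ({..<n} \<times> ?D)"
  proof (rule card_inj_on_le[where f = "\<lambda>(i, j). (i, int j - int i)"])
    show "inj_on (\<lambda>(i, j). (i, int j - int i)) ?S"
      by (auto simp: inj_on_def)
  qed auto
  also have "\<dots> = 2 * k * n"
    by (simp add: card_cartesian_product card_Diff_subset nat_add_distrib nat_mult_distrib)
  finally show ?thesis .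
qed

text \<open>Each ordered pair of distinct letters is read off at some ordered pair of distinct close
  positions, and different letter pairs need different position pairs.\<close>

lemma min_radius_length_ge:
  assumes "k \<ge> 1"
  shows "n * (n - 1) \<le> 2 * k * min_radius_length k n"
proof -
  obtain xs where len: "length xs = min_radius_length k n" and xs: "radius_sequence k {..<n} xs"
    using min_radius_length_attained[OF assms] by blast
  let ?S = "{(i, j). i < length xs \<and> j < length xs \<and> i \<noteq> j \<and> \<bar>int i - int j\<bar> \<le> int k}"
  let ?P = "Sigma {..<n} (\<lambda>a. {..<n} - {a})"
  have "?P \<subseteq> (\<lambda>(i, j). (xs ! i, xs ! j)) ` ?S"
  proof
    fix p assume "p \<in> ?P"
    then obtain a b where p: "p = (a, b)" and "a \<in> {..<n}" "b \<in> {..<n}" "b \<noteq> a"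
      by auto
    then obtain i j where "i < length xs" "j < length xs" "xs ! i = a" "xs ! j = b"
        "\<bar>int i - int j\<bar> \<le> int k"
      using xs unfolding radius_sequence_def by blast
    with \<open>b \<noteq> a\<close> show "p \<in> (\<lambda>(i, j). (xs ! i, xs ! j)) ` ?S"
      by (intro image_eqI[of _ _ "(i, j)"]) (auto simp: p)
  qed
  moreover have fin: "finite ?S"
    by (rule finite_subset[of _ "{..<length xs} \<times> {..<length xs}"]) auto
  ultimately have "card ?P \<le> card ?S"
    by (rule surj_card_le[rotated])
  also have "\<dots> \<le> 2 * k * length xs"
    by (rule card_close_index_pairs)
  finally show ?thesis
    by (simp add: len card_SigmaI card_Diff_subset)
qed

section \<open>The product construction\<close>

text \<open>Coprimality makes \<open>d\<close> invertible modulo \<open>m\<close>, so the slope can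
  be solved for.\<close>

lemma affine_cong_solvable:
  fixes d m u v :: nat
  assumes "coprime d m" "m > 0"
  obtains s where "s < m" "[u + d * s = v] (mod m)"
proof -
  obtain x where x: "[d * x = 1] (mod m)"
    using cong_solve_coprime_nat[OF assms(1)] by auto
  \<comment> \<open>The term \<open>u * (m - 1)\<close> stands for \<open>-u\<close> modulo
    \<open>m\<close>, which avoids truncated subtraction.\<close>
  define w where "w = v + u * (m - 1)"
  have "[u + d * (x * w mod m) = u + d * (x * w)] (mod m)"
    by (intro cong_add cong_mult cong_refl) (simp add: Cong.cong_def)
  also have "u + d * (x * w) = u + (d * x) * w"
    by simp
  also have "[u + (d * x) * w = u + 1 * w] (mod m)"
    by (intro cong_add cong_mult cong_refl x)
  also have "u + 1 * w = v + u * m"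
    using assms(2) by (cases m) (simp_all add: w_def)
  also have "[v + u * m = v] (mod m)"
    unfolding Cong.cong_def by simp
  finally show ?thesis
    using that[of "x * w mod m"] assms(2) by simp
qed

definition run_symbol :: "nat \<Rightarrow> nat \<Rightarrow> nat \<Rightarrow> nat \<Rightarrow> nat \<times> nat" where
  "run_symbol q m \<beta> t =
     (t mod q, ((t div q) * (t mod q) + q * (\<Sum>r<t div q. r) + \<beta>) mod m)"

text \<open>The $s$-th block of a run is a line of slope $s$ through the groups. The intercept is
  advanced by $qs$ from this block to the next, so that a step of length $d$ moves the second
  coordinate by $sd$ plus a constant whether or not it crosses a block boundary.\<close>

lemma run_symbol_step:
  assumes "i < q" "j < q" "j = i + d \<or> j + q = i + d"
  obtains v where "\<And>\<beta>. run_symbol q m \<beta> (s * q + i) = (i, (v + \<beta>) mod m)"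
    "\<And>\<beta>. run_symbol q m \<beta> (s * q + i + d) =
        (j, (v + \<beta> + ((if j = i + d then 0 else j) + d * s)) mod m)"
proof
  define v where "v = s * i + q * (\<Sum>r<s. r)"
  show "run_symbol q m \<beta> (s * q + i) = (i, (v + \<beta>) mod m)" for \<beta>
    using assms(1) by (simp add: run_symbol_def v_def)
  show "run_symbol q m \<beta> (s * q + i + d) =
      (j, (v + \<beta> + ((if j = i + d then 0 else j) + d * s)) mod m)" for \<beta>
  proof (cases "j = i + d")
    case True
    then have t: "s * q + i + d = s * q + j"
      by simp
    have "(s * q + j) div q = s" "(s * q + j) mod q = j"
      using assms(2) by simp_all
    then show ?thesis
      unfolding t run_symbol_def using True by (simp add: v_def algebra_simps)
  next
    case False
    then have eq: "j + q = i + d"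
      using assms(3) by simp
    then have t: "s * q + i + d = Suc s * q + j"
      by simp
    \<comment> \<open>Past the block boundary the slope grows by one, which contributes
      \<open>j\<close>, and the intercept grows by \<open>q * s\<close>. The sum
      \<open>s * j + q * s\<close> is then \<open>s * i + s * d\<close>.\<close>
    have "s * (j + q) = s * (i + d)"
      by (simp only: eq)
    then have "Suc s * j + q * (\<Sum>r<Suc s. r) = v + (j + d * s)"
      by (simp add: v_def algebra_simps)
    moreover have "(Suc s * q + j) div q = Suc s" "(Suc s * q + j) mod q = j"
      using assms(2) by (simp_all del: mult_Suc)
    ultimately show ?thesis
      unfolding t run_symbol_def using False by (simp only: if_False add_ac)
  qed
qed

text \<open>The increment between the two positions does not depend on \<open>\<beta>\<close>. So
  the slope \<open>s\<close> is chosen first to produce the difference from \<open>x\<close> to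
  \<open>y\<close>, and then \<open>\<beta>\<close> shifts the starting value to
  \<open>x\<close>.\<close>

lemma run_hits:
  assumes "coprime d m" "x < m" "y < m" "i < q" "j < q" "j = i + d \<or> j + q = i + d"
  obtains s \<beta> where "s < m" "\<beta> < m" "run_symbol q m \<beta> (s * q + i) = (i, x)"
    "run_symbol q m \<beta> (s * q + i + d) = (j, y)"
proof -
  define e where "e = (if j = i + d then 0 else j)"
  obtain s where s: "s < m" "[(x + e) + d * s = y] (mod m)"
    using affine_cong_solvable[OF assms(1)] assms(2) by (metis gr_zeroI not_less_zero)
  obtain v where v: "\<And>\<beta>. run_symbol q m \<beta> (s * q + i) = (i, (v + \<beta>) mod m)"
      "\<And>\<beta>. run_symbol q m \<beta> (s * q + i + d) = (j, (v + \<beta> + (e + d * s)) mod m)"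
    using run_symbol_step[OF assms(4-6)] unfolding e_def by blast
  obtain \<beta> where \<beta>: "\<beta> < m" "[v + 1 * \<beta> = x] (mod m)"
    using affine_cong_solvable[of 1 m v x] assms(2) by auto
  have "[v + \<beta> + (e + d * s) = x + (e + d * s)] (mod m)"
    using \<beta>(2) by (intro cong_add cong_refl) simp
  with s(2) have "[v + \<beta> + (e + d * s) = y] (mod m)"
    by (metis add.assoc cong_trans)
  then have "(v + \<beta> + (e + d * s)) mod m = y" "(v + \<beta>) mod m = x"
    using \<beta>(2) assms(2,3) by (simp_all only: Cong.cong_def mod_less mult_1)
  then show ?thesis
    using that[of s \<beta>] s(1) \<beta>(1) v[of \<beta>] by simp
qed

text \<open>The slopes below \<open>m\<close> occupy blocks \<open>0\<close> to
  \<open>m - 1\<close>; one further block lets a step from the last of them wrap around.\<close>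

definition run :: "nat \<Rightarrow> nat \<Rightarrow> nat \<Rightarrow> (nat \<times> nat) list" where
  "run q m \<beta> = map (run_symbol q m \<beta>) [0..<q * Suc m]"

lemma run_close:
  assumes "coprime d m" "x < m" "y < m" "i < q" "j < q" "j = i + d \<or> j + q = i + d"
    and "d \<le> k"
  obtains \<beta> where "\<beta> < m" "close_in k (run q m \<beta>) (i, x) (j, y)"
proof -
  obtain s \<beta> where s: "s < m" "\<beta> < m" "run_symbol q m \<beta> (s * q + i) = (i, x)"
    "run_symbol q m \<beta> (s * q + i + d) = (j, y)"
    using run_hits[OF assms(1-6)] by blast
  have "s * q + i + d < Suc s * q + q"
    using assms(4-6) by auto
  also have "\<dots> \<le> q * Suc m"
    using mult_le_mono2[of "Suc (Suc s)" "Suc m" q] s(1) by (simp add: algebra_simps)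
  finally show ?thesis
    using that[OF s(2)] close_in_map_upt[OF _ assms(7), of "s * q + i" _ "run_symbol q m \<beta>"] s(3,4)
    by (simp add: run_def)
qed

text \<open>The \<open>m\<close> runs, one for each intercept, serve the pairs from different
  groups; a copy of an optimal word for \<open>m\<close> letters in each group serves the
  others.\<close>

lemma min_radius_length_product:
  assumes "k \<ge> 1" "m \<ge> 1" and coprime: "\<And>d. d \<in> {1..k} \<Longrightarrow> coprime d m"
    and q: "q = 2 * k + 1"
  shows "min_radius_length k (q * m) \<le> q * m * (m + 1) + q * min_radius_length k m"
proof -
  obtain zs where zs: "length zs = min_radius_length k m" "radius_sequence k {..<m} zs"
    using min_radius_length_attained[OF assms(1)] by blast
  define runs where "runs = concat (map (run q m) [0..<m])"
  define groups where "groups = concat (map (\<lambda>i. map (Pair i) zs) [0..<q])"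
  have across: "close_in k runs (i, x) (j, y)"
    if *: "x < m" "y < m" "i < q" "j < q" "j = i + d \<or> j + q = i + d" and d: "d \<in> {1..k}"
    for i j x y d
  proof -
    obtain \<beta> where "\<beta> < m" "close_in k (run q m \<beta>) (i, x) (j, y)"
      using run_close[OF coprime[OF d] *, of k] d by auto
    then show ?thesis
      unfolding runs_def by (intro close_in_concat[of "run q m \<beta>"]) auto
  qed
  have close: "close_in k (runs @ groups) (i, x) (j, y)"
    if *: "x < m" "y < m" "i < q" "j < q" for i j x y
  proof (cases "i = j")
    case True
    have "close_in k (map (Pair i) zs) (i, x) (i, y)"
      using zs(2) * by (intro close_in_map) (simp add: radius_sequence_iff)
    then have "close_in k groups (i, x) (i, y)"
      unfolding groups_def using * by (intro close_in_concat[of "map (Pair i) zs"]) auto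
    then show ?thesis
      using close_in_append[of k groups _ _ runs "[]"] True by simp
  next
    case False
    \<comment> \<open>The two arcs between \<open>i\<close> and \<open>j\<close> on a cycle of
      length \<open>2 * k + 1\<close> add up to \<open>2 * k + 1\<close>, so one of them has length
      at most \<open>k\<close>.\<close>
    have "\<exists>d\<in>{1..k}. j = i + d \<or> j + q = i + d \<or> i = j + d \<or> i + q = j + d"
    proof (cases "i < j")
      case True
      show ?thesis
        by (rule bexI[of _ "if j - i \<le> k then j - i else i + q - j"]) (use True * q in auto)
    next
      case False
      with \<open>i \<noteq> j\<close> show ?thesis
        by (intro bexI[of _ "if i - j \<le> k then i - j else j + q - i"]) (use * q in auto)
    qed
    then have "close_in k runs (i, x) (j, y)"
      using across * close_in_sym[of k runs] by metis
    then show ?thesis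
      using close_in_append[of k runs _ _ "[]" groups] by simp
  qed
  have "set runs \<subseteq> {..<q} \<times> {..<m}"
    using assms(2) q by (auto simp: runs_def run_def run_symbol_def)
  moreover have "set groups \<subseteq> {..<q} \<times> {..<m}"
    using zs(2) by (auto simp: groups_def radius_sequence_def)
  ultimately have "radius_sequence k ({..<q} \<times> {..<m}) (runs @ groups)"
    using close by (auto simp: radius_sequence_iff)
  from min_radius_length_le[OF _ this]
  have "min_radius_length k (q * m) \<le> length runs + length groups"
    by (simp add: card_cartesian_product)
  also have "length runs = q * m * (m + 1)"
    by (simp add: runs_def run_def length_concat comp_def sum_list_triv algebra_simps)
  also have "length groups = q * min_radius_length k m"
    by (simp add: groups_def zs(1) length_concat comp_def sum_list_triv)
  finally show ?thesis .
qed

section \<open>The upper bound\<close>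

lemma min_radius_length_recursion:
  assumes "k \<ge> 1" and q: "q = 2 * k + 1"
  obtains m where "m \<ge> 1" "n \<le> q * m" "q * m \<le> n + q * (fact k + 1)"
    "min_radius_length k n \<le> q * m * (m + 1) + q * min_radius_length k m"
proof -
  define c where "c = n div (q * fact k)"
  \<comment> \<open>This \<open>m\<close> is 1 modulo every \<open>d\<close> in
    \<open>{1..k}\<close>, hence coprime to it. Using \<open>c + 1\<close> instead of
    \<open>c\<close> rounds up, so that \<open>q * m\<close> reaches \<open>n\<close>.\<close>
  define m where "m = fact k * (c + 1) + 1"
  have "coprime d m" if "d \<in> {1..k}" for d
  proof -
    have "d dvd fact k * (c + 1)"
      using that by (intro dvd_mult2 dvd_fact) auto
    then have "coprime (fact k * (c + 1) + 1) d"
      by (metis coprime_add_one_left coprime_divisors dvd_refl coprime_commute)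
    then show ?thesis
      by (simp add: m_def coprime_commute)
  qed
  then have le: "min_radius_length k (q * m) \<le> q * m * (m + 1) + q * min_radius_length k m"
    using assms by (intro min_radius_length_product) (auto simp: m_def)
  have "n mod (q * fact k) < q * fact k"
    using q by simp
  then have "n \<le> q * fact k * (c + 1)" "q * fact k * c \<le> n"
    using div_mult_mod_eq[of n "q * fact k"] by (auto simp: c_def algebra_simps)
  then have "n \<le> q * m" "q * m \<le> n + q * (fact k + 1)"
    by (auto simp: m_def algebra_simps)
  moreover from this(1) have "min_radius_length k n \<le> min_radius_length k (q * m)"
    by (intro min_radius_length_mono assms)
  ultimately show ?thesis
    using that[of m] le by (simp add: m_def)
qed

text \<open>Strong induction along the recursion. The quadratic term reproduces itself, and since
  \<open>m\<close> is at most \<open>2 / 3 * n\<close>, the logarithm drops by at least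
  \<open>1 / 3\<close>; this gain absorbs all linear errors once \<open>K\<close> is large.\<close>

lemma min_radius_length_upper:
  assumes "k \<ge> 1"
  obtains K :: real where
    "\<And>n. real (min_radius_length k n) \<le> (real n)\<^sup>2 / (2 * real k) + K * (real n * (ln (real n) + 1))"
proof -
  define f where "f n = real (min_radius_length k n)" for n
  define q where "q = 2 * k + 1"
  define C where "C = real (q * (fact k + 1))"
  have C: "C \<ge> 0"
    by (simp add: C_def)
  \<comment> \<open>Half of the gain \<open>n / 3\<close> pays for the excess \<open>C\<close> of
    \<open>q * m\<close> over \<open>n\<close>; the other half, \<open>n / 6\<close>,
    remains.\<close>
  have "eventually (\<lambda>n::nat. C * ln (real n) + 2 / 3 * C \<le> real n / 6) at_top"
    by real_asymp
  then obtain N :: nat where N: "\<And>n. n \<ge> N \<Longrightarrow> C * ln (real n) + 2 / 3 * C \<le> real n / 6"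
    unfolding eventually_at_top_linorder by blast
  \<comment> \<open>From \<open>n0\<close> on, \<open>n > C\<close> holds, so
    \<open>3 * m \<le> q * m \<le> n + C < 2 * n\<close>.\<close>
  define n0 where "n0 = max (nat \<lceil>C\<rceil> + 1) N"
  \<comment> \<open>The first summand makes \<open>K / 6\<close> outweigh the linear error
    \<open>2 * C + 2\<close>; the sum covers all \<open>n < n0\<close> at once.\<close>
  define K where "K = 6 * (2 * C + 2) + (\<Sum>i<n0. f i)"
  have K: "K \<ge> 6 * (2 * C + 2)"
    by (simp add: K_def f_def sum_nonneg)
  moreover have "0 \<le> 6 * (2 * C + 2)"
    using C by simp
  ultimately have "0 \<le> K"
    by (rule order_trans[rotated])
  have "f n \<le> (real n)\<^sup>2 / (2 * real k) + K * (real n * (ln (real n) + 1))" for n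
  proof (induction n rule: less_induct)
    case (less n)
    consider "n = 0" | "n \<ge> 1" "n < n0" | "n \<ge> n0"
      by linarith
    then show ?case
    proof cases
      case 1
      have "radius_sequence k {..<0::nat} []"
        by (simp add: radius_sequence_def)
      from min_radius_length_le[OF _ this] show ?thesis
        using 1 by (simp add: f_def)
    next
      case 2
      have "f n \<le> (\<Sum>i<n0. f i)"
        using 2 by (intro member_le_sum) (auto simp: f_def)
      also have "\<dots> \<le> K * 1"
        using C by (simp add: K_def)
      also have "\<dots> \<le> K * (real n * (ln (real n) + 1))"
      proof (intro mult_left_mono)
        have "1 * 1 \<le> real n * (ln (real n) + 1)"
          using 2 by (intro mult_mono) auto
        then show "1 \<le> real n * (ln (real n) + 1)"
          by simp
      qed (rule \<open>0 \<le> K\<close>)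
      finally show ?thesis
        by (simp add: add_increasing)
    next
      case 3
      then have n: "n \<ge> 1" "real n > C" "n \<ge> N"
        unfolding n0_def by linarith+
      obtain m where m: "m \<ge> 1" "n \<le> q * m" "q * m \<le> n + q * (fact k + 1)"
        "min_radius_length k n \<le> q * m * (m + 1) + q * min_radius_length k m"
        using min_radius_length_recursion[OF assms q_def] by blast
      define M where "M = real q * real m"
      have "M \<le> real (n + q * (fact k + 1))"
        unfolding M_def using m(3) of_nat_mono by (metis of_nat_mult)
      then have M: "M \<le> real n + C"
        by (simp add: C_def)
      have "3 * real m \<le> M"
        unfolding M_def using assms by (intro mult_right_mono) (auto simp: q_def)
      then have m23: "real m \<le> real n * (2 / 3)"
        using M n(2) by simp
      then have "m < n"
        using n(1) by linarith
      have "ln (real m) \<le> ln (real n * (2 / 3))"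
        using m23 m(1) n(1) by simp
      also have "\<dots> = ln (real n) + ln (2 / 3)"
        using n(1) by (intro ln_mult_pos) auto
      also have "ln (2 / 3 :: real) \<le> - 1 / 3"
        using ln_le_minus_one[of "2 / 3 :: real"] by simp
      finally have ln_m: "ln (real m) + 1 \<le> ln (real n) + 2 / 3"
        by simp
      have "M * (ln (real m) + 1) \<le> (real n + C) * (ln (real n) + 2 / 3)"
        using M ln_m m(1) n(1) C by (intro mult_mono) auto
      also have "\<dots> \<le> real n * (ln (real n) + 1) - real n / 6"
        using N[OF n(3)] by (simp add: algebra_simps add_divide_distrib)
      finally have main: "M * (ln (real m) + 1) \<le> real n * (ln (real n) + 1) - real n / 6" .
      have "M\<^sup>2 \<le> (real n + C)\<^sup>2"
        using M by (intro power_mono) (auto simp: M_def)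
      also have "\<dots> \<le> (real n)\<^sup>2 + 3 * C * real n"
        using mult_left_mono[OF less_imp_le[OF n(2)] C] by (simp add: power2_eq_square algebra_simps)
      finally have "M\<^sup>2 / (2 * real k) \<le> ((real n)\<^sup>2 + 3 * C * real n) / (2 * real k)"
        by (intro divide_right_mono) auto
      also have "\<dots> = (real n)\<^sup>2 / (2 * real k) + 3 * C * real n / (2 * real k)"
        by (rule add_divide_distrib)
      also have "3 * C * real n / (2 * real k) \<le> 3 * C * real n / 2"
        using assms C by (intro divide_left_mono) auto
      also have "3 * C * real n / 2 \<le> 2 * C * real n"
        using C by simp
      finally have M2: "M\<^sup>2 / (2 * real k) \<le> (real n)\<^sup>2 / (2 * real k) + 2 * C * real n"
        by simp
      have "f n \<le> real (q * m * (m + 1) + q * min_radius_length k m)"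
        unfolding f_def using m(4) of_nat_mono by blast
      also have "\<dots> = M * real m + M + real q * f m"
        by (simp add: f_def M_def algebra_simps)
      also have "\<dots> \<le> M * real m + M +
          real q * ((real m)\<^sup>2 / (2 * real k) + K * (real m * (ln (real m) + 1)))"
        by (intro add_left_mono mult_left_mono less.IH[OF \<open>m < n\<close>]) auto
      \<comment> \<open>Because \<open>q = 2 * k + 1\<close>, the terms \<open>M * m\<close> and
        \<open>q * m\<^sup>2 / (2 * k)\<close> add up to exactly
        \<open>M\<^sup>2 / (2 * k)\<close>.\<close>
      also have "\<dots> = M\<^sup>2 / (2 * real k) + M + K * (M * (ln (real m) + 1))"
        using assms by (simp add: M_def q_def field_simps power2_eq_square)
      also have "\<dots> \<le> ((real n)\<^sup>2 / (2 * real k) + 2 * C * real n) + 2 * real n +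
          K * (real n * (ln (real n) + 1) - real n / 6)"
        using M2 M n(2) K C by (intro add_mono mult_left_mono main) auto
      also have "\<dots> = (real n)\<^sup>2 / (2 * real k) + K * (real n * (ln (real n) + 1)) +
          (2 * C + 2 - K / 6) * real n"
        by (simp add: algebra_simps)
      also have "\<dots> \<le> (real n)\<^sup>2 / (2 * real k) + K * (real n * (ln (real n) + 1))"
        using K by (simp add: mult_nonpos_nonneg)
      finally show ?thesis .
    qed
  qed
  then show ?thesis
    unfolding f_def by (rule that)
qed

section \<open>Two-sided estimate and comparison of the error terms\<close>

lemma min_radius_length_asymp:
  assumes "k \<ge> 1"
  shows "(\<lambda>n. real (min_radius_length k n) - 1 / (2 * real k) * (real n)\<^sup>2)
           \<in> O(\<lambda>n. real n * (ln (real n) + 1))"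
proof -
  obtain K where K: "\<And>n. real (min_radius_length k n) \<le>
      (real n)\<^sup>2 / (2 * real k) + K * (real n * (ln (real n) + 1))"
    using min_radius_length_upper[OF assms] by blast
  show ?thesis
  \<comment> \<open>The constant \<open>K\<close> serves the upper bound and \<open>1\<close> the
    lower one.\<close>
  proof (rule bigoI[of _ "max K 1"], rule eventually_mono[OF eventually_ge_at_top[of "1::nat"]])
    fix n :: nat assume n: "1 \<le> n"
    let ?g = "real n * (ln (real n) + 1)"
    let ?F = "real (min_radius_length k n)"
    have g: "real n * 1 \<le> ?g"
      using n by (intro mult_left_mono) auto
    \<comment> \<open>Counting falls short of the quadratic term only by \<open>n / (2 * k)\<close>,
      which is at most \<open>n\<close> and hence at most \<open>?g\<close>.\<close>
    have "real (n * (n - 1)) \<le> real (2 * k * min_radius_length k n)"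
      using min_radius_length_ge[OF assms] of_nat_mono by blast
    then have "real n * (real n - 1) \<le> 2 * real k * ?F"
      using n by (simp add: of_nat_diff)
    then have "(real n)\<^sup>2 / (2 * real k) - real n / (2 * real k) \<le> ?F"
      using assms by (simp add: field_simps power2_eq_square)
    moreover have "real n / (2 * real k) \<le> real n / 1"
      using assms by (intro divide_left_mono) auto
    ultimately have lower: "(real n)\<^sup>2 / (2 * real k) - ?g \<le> ?F"
      using g by linarith
    have "1 * ?g \<le> max K 1 * ?g" "K * ?g \<le> max K 1 * ?g"
      using g by (intro mult_right_mono; simp)+
    with lower K[of n] have "\<bar>?F - (real n)\<^sup>2 / (2 * real k)\<bar> \<le> max K 1 * ?g"
      by linarith
    then show "norm (?F - 1 / (2 * real k) * (real n)\<^sup>2) \<le> max K 1 * norm ?g"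
      using g by simp
  qed
qed

text \<open>For \<open>c > 0\<close> the factor \<open>n powr (c / ln (ln n))\<close> equals
  \<open>exp (c * ln n / ln (ln n))\<close> for large \<open>n\<close>, which outgrows
  \<open>ln n\<close>.\<close>

lemma n_ln_n_bigo_h:
  assumes "\<epsilon> > 0"
  shows "(\<lambda>n::nat. real n * (ln (real n) + 1)) \<in> O(\<lambda>n. h \<epsilon> (real n))"
proof -
  define c where "c = ln 2 + \<epsilon>"
  have "c > 0"
    using assms by (simp add: c_def add_pos_pos)
  then have "(\<lambda>n::nat. real n * (ln (real n) + 1)) \<in> O(\<lambda>n. real n powr (1 + c / ln (ln (real n))))"
    by real_asymp
  then show ?thesis
    by (simp add: h_def c_def)
qed

theorem theorem1:
  fixes k :: nat and \<epsilon> :: real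
  assumes "k \<ge> 1" and "\<epsilon> > 0"
  shows "(\<lambda>n. real (min_radius_length k n) - 1 / (2 * real k) * (real n)\<^sup>2)
           \<in> O[at_top](\<lambda>n. h \<epsilon> (real n)) \<and>
         (\<lambda>n. real (min_radius_length k n) - 1 / (2 * real k) * (real n)\<^sup>2)
           \<in> O[at_top](\<lambda>n. real n powr (1 + \<epsilon>))"
proof
  show "(\<lambda>n. real (min_radius_length k n) - 1 / (2 * real k) * (real n)\<^sup>2)
      \<in> O[at_top](\<lambda>n. h \<epsilon> (real n))"
    by (rule landau_o.big_trans[OF min_radius_length_asymp n_ln_n_bigo_h]) (use assms in auto)
  have "(\<lambda>n::nat. real n * (ln (real n) + 1)) \<in> O(\<lambda>n. real n powr (1 + \<epsilon>))"
    using assms(2) by real_asymp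
  then show "(\<lambda>n. real (min_radius_length k n) - 1 / (2 * real k) * (real n)\<^sup>2)
      \<in> O[at_top](\<lambda>n. real n powr (1 + \<epsilon>))"
    using landau_o.big_trans[OF min_radius_length_asymp[OF assms(1)]] by blast
qed

end
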